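(* Let $A=(a_{ij})$ be an $n\times n$ DW-Toeplitz matrix and let $B=(b_{ij})$ be an $n\times n$ matrix which is a conic combination of a Kalmanson matrix and a cyclic PS monotone Monge matrix. Then the identity permutation is an optimal solution of $QAP(A,B)$, i.e. for every permutation $\pi$ of $\{1,\ldots,n\}$, $$\sum_{i=1}^n\sum_{j=1}^n a_{ij}\,b_{ij}\;\le\;\sum_{i=1}^n\sum_{j=1}^n a_{\pi(i)\pi(j)}\,b_{ij}.$$
   Context: $QAP(A,B)$: for real $n\times n$ matrices $A=(a_{ij})$, $B=(b_{ij})$, minimize $Z_\pi(A,B)=\sum_{i,j=1}^n a_{\pi(i)\pi(j)}b_{ij}$ over all permutations $\pi$ of $\{1,\ldots,n\}$. A conic combination is a linear combination with non-negative coefficients. Permuting a matrix $M=(m_{ij})$ according to a permutation $\pi$ yields the matrix with entries $m_{\pi(i)\pi(j)}$. A Toeplitz matrix with generating function $f\colon\{-n+1,\ldots,n-1\}\to\mathbb{R}$ is the $n\times n$ matrix with entries $f(i-j)$. A DW-Toeplitz matrix is a symmetric $n\times n$ circulant matrix (Toeplitz with $f(i)=f(i-n)$ for $1\le i\le n-1$) whose generating function satisfies $f(0)=0$, $f(1)\ge f(2)\ge\cdots\ge f(\lceil\frac{n-1}{2}\rceil)$, and $f(i)=f(n-i)$ for all $i>\lceil\frac{n-1}{2}\rceil$. A symmetric $n\times n$ matrix $(c_{ij})$ is a Kalmanson matrix if $c_{ij}+c_{kl}\le c_{ik}+c_{jl}$ and $c_{ik}+c_{jl}\ge c_{il}+c_{jk}$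 for all $1\le i<j<k<l\le n$. For $1\le p,q\le n$ let $R^{(p,q)}$ be the $n\times n$ $0$-$1$ matrix whose $(i,j)$ entry is $1$ if and only if $n-p+1\le i\le n$ and $n-q+1\le j\le n$. Put $\bar R^{(p,q)}=R^{(p,q)}+R^{(q,p)}$ for $1\le p<q\le n$ and $\bar R^{(p,p)}=R^{(p,p)}$. The Supnick permutation is $\pi^*=\langle 1,3,5,\ldots,6,4,2\rangle$, i.e. $\pi^*(1),\ldots,\pi^*(n)$ lists first the odd numbers in $\{1,\ldots,n\}$ increasingly and then the even numbers decreasingly. For $1\le u\le n$ let $\sigma_u=\langle u,u+1,\ldots,n,1,\ldots,u-1\rangle$. The cyclic PS monotone Monge matrices are the matrices obtained by first permuting $-\bar R^{(p,q)}$ according to $\pi^*$ and then permuting the resulting matrix according to $\sigma_u$, for $1\le p\le q\le n$ and $1\le u\le n$. *)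

theory Defs
  imports Complex_Main "HOL-Combinatorics.Permutations"
begin

text \<open>An \<open>n \<times> n\<close> matrix is a function \<open>nat \<Rightarrow> nat \<Rightarrow> real\<close> of which only the entries
  with both indices in \<open>{1..n}\<close> are meaningful. All notions below only constrain
  those entries.\<close>

type_synonym matr = "nat \<Rightarrow> nat \<Rightarrow> real"

definition mat_eq :: "nat \<Rightarrow> matr \<Rightarrow> matr \<Rightarrow> bool" where
  "mat_eq n A B \<longleftrightarrow> (\<forall>i\<in>{1..n}. \<forall>j\<in>{1..n}. A i j = B i j)"

definition symmetric_mat :: "nat \<Rightarrow> matr \<Rightarrow> bool" where
  "symmetric_mat n A \<longleftrightarrow> (\<forall>i\<in>{1..n}. \<forall>j\<in>{1..n}. A i j = A j i)"

definition permute_mat :: "(nat \<Rightarrow> nat) \<Rightarrow> matr \<Rightarrow> matr" where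
  "permute_mat \<pi> M = (\<lambda>i j. M (\<pi> i) (\<pi> j))"

definition qap_cost :: "nat \<Rightarrow> matr \<Rightarrow> matr \<Rightarrow> (nat \<Rightarrow> nat) \<Rightarrow> real" where
  "qap_cost n A B \<pi> = (\<Sum>i=1..n. \<Sum>j=1..n. A (\<pi> i) (\<pi> j) * B i j)"

definition qap_optimal :: "nat \<Rightarrow> matr \<Rightarrow> matr \<Rightarrow> (nat \<Rightarrow> nat) \<Rightarrow> bool" where
  "qap_optimal n A B \<pi> \<longleftrightarrow> \<pi> permutes {1..n} \<and>
     (\<forall>\<rho>. \<rho> permutes {1..n} \<longrightarrow> qap_cost n A B \<pi> \<le> qap_cost n A B \<rho>)"

text \<open>The generating function is total on the integers; only its values on
  \<open>{- n + 1..n - 1}\<close> matter.\<close>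

definition toeplitz :: "nat \<Rightarrow> (int \<Rightarrow> real) \<Rightarrow> matr \<Rightarrow> bool" where
  "toeplitz n f A \<longleftrightarrow> mat_eq n A (\<lambda>i j. f (int i - int j))"

definition circulant :: "nat \<Rightarrow> (int \<Rightarrow> real) \<Rightarrow> matr \<Rightarrow> bool" where
  "circulant n f A \<longleftrightarrow> toeplitz n f A \<and> (\<forall>i\<in>{1..int n - 1}. f i = f (i - int n))"

definition DW_toeplitz :: "nat \<Rightarrow> matr \<Rightarrow> bool" where
  "DW_toeplitz n A \<longleftrightarrow> symmetric_mat n A \<and>
     (\<exists>f. circulant n f A \<and> f 0 = 0 \<and>
        antimono_on {1..\<lceil>(real n - 1) / 2\<rceil>} f \<and>
        (\<forall>i. \<lceil>(real n - 1) / 2\<rceil> < i \<and> i \<le> int n - 1 \<longrightarrow> f i = f (int n - i)))"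

definition kalmanson :: "nat \<Rightarrow> matr \<Rightarrow> bool" where
  "kalmanson n C \<longleftrightarrow> symmetric_mat n C \<and>
     (\<forall>i j k l. 1 \<le> i \<and> i < j \<and> j < k \<and> k < l \<and> l \<le> n \<longrightarrow>
        C i j + C k l \<le> C i k + C j l \<and> C i k + C j l \<ge> C i l + C j k)"

definition R_mat :: "nat \<Rightarrow> nat \<Rightarrow> nat \<Rightarrow> matr" where
  "R_mat n p q = (\<lambda>i j.
     if n - p + 1 \<le> i \<and> i \<le> n \<and> n - q + 1 \<le> j \<and> j \<le> n then 1 else 0)"

definition R_bar :: "nat \<Rightarrow> nat \<Rightarrow> nat \<Rightarrow> matr" where
  "R_bar n p q = (\<lambda>i j. if p = q then R_mat n p p i j else R_mat n p q i j + R_mat n q p i j)"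

text \<open>One-line notation: \<open>\<langle>x\<^sub>1, \<dots>, x\<^sub>n\<rangle>\<close> maps \<open>i\<close> to \<open>x\<^sub>i\<close>, whereas list indices start at \<open>0\<close>.\<close>

definition one_line :: "nat list \<Rightarrow> nat \<Rightarrow> nat" where
  "one_line xs i = xs ! (i - 1)"

definition supnick :: "nat \<Rightarrow> nat \<Rightarrow> nat" where
  "supnick n = one_line (filter odd [1..<Suc n] @ rev (filter even [1..<Suc n]))"

definition cyc_shift :: "nat \<Rightarrow> nat \<Rightarrow> nat \<Rightarrow> nat" where
  "cyc_shift n u = one_line ([u..<Suc n] @ [1..<u])"

definition cyclic_PS_monotone_Monge :: "nat \<Rightarrow> matr \<Rightarrow> bool" where
  "cyclic_PS_monotone_Monge n M \<longleftrightarrow>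
     (\<exists>p q u. 1 \<le> p \<and> p \<le> q \<and> q \<le> n \<and> 1 \<le> u \<and> u \<le> n \<and>
        mat_eq n M
          (permute_mat (cyc_shift n u) (permute_mat (supnick n) (\<lambda>i j. - R_bar n p q i j))))"

definition conic_combination2 :: "nat \<Rightarrow> matr \<Rightarrow> matr \<Rightarrow> matr \<Rightarrow> bool" where
  "conic_combination2 n B K M \<longleftrightarrow>
     (\<exists>\<alpha> \<beta>. 0 \<le> \<alpha> \<and> 0 \<le> \<beta> \<and> mat_eq n B (\<lambda>i j. \<alpha> * K i j + \<beta> * M i j))"

end

theory Submission
  imports Defs
begin

text \<open>
  Off the diagonal, \<open>A i j\<close> is a decreasing function \<open>\<phi>\<close> of the cyclic distance of \<open>i\<close> and \<open>j\<close>. For a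
  permutation \<open>\<rho>\<close> let \<open>D\<close> be the matrix \<open>A\<close> permuted by \<open>\<rho>\<close>, minus \<open>A\<close>. The claim is that
  \<open>\<Sum>i j. D i j * B i j \<ge> 0\<close>, and by linearity \<open>B\<close> may be either of the two given matrices. Both cases reduce to
  one geometric fact, a rearrangement inequality on the cycle (\<open>cyclic_rearrangement\<close>): among all pairs of
  sets \<open>P\<close>, \<open>Q\<close> of prescribed sizes, two concentric arcs maximise the sum of \<open>\<phi>\<close> over the distances
  between points of \<open>P\<close> and points of \<open>Q\<close>. In other words, sums of \<open>D\<close> over blocks of concentric arcs are at
  most zero.

  The rearrangement inequality is proved layer by layer, so that \<open>\<phi>\<close> becomes the indicator of distance at most
  \<open>r\<close>, and the quantity to maximise is the sum over \<open>x \<in> P\<close> of the number of points of \<open>Q\<close> in the window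
  of radius \<open>r\<close> about \<open>x\<close>. For every threshold \<open>t\<close>, the total excess of these numbers over \<open>t\<close> is largest when
  \<open>Q\<close> is an arc (\<open>excess_max_arc\<close>, a relative of Pollard's theorem): by double counting the excess is
  \<open>\<Sum>a\<in>Q. max 0 (m - G a)\<close>, with \<open>m = 2 * r + 1\<close> and \<open>G a\<close> the distance from \<open>a\<close> back to the \<open>t\<close>-th
  element of \<open>Q\<close> before it. The numbers \<open>G a\<close> have a prescribed sum and range, and the arc pushes them to the
  ends of that range, where a convex function has its largest sum. For the arc, the concentric arc \<open>P\<close> is a
  level set of the window counts (\<open>win_arc_level\<close>), and on a level set the bound by excesses is attained
  (\<open>window_sum_le\<close>).

  The level sets of the Supnick permutation are concentric arcs (\<open>PS_level_arc\<close>, \<open>half_gaps\<close>), so a cyclic PS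
  monotone Monge matrix is minus a symmetrised indicator of a product of concentric arcs, and the inequality
  applies directly. For a Kalmanson matrix, two summations by parts express the form through sums of \<open>D\<close> over
  square blocks of arcs, with coefficients whose signs are given by the Kalmanson conditions
  (\<open>kalmanson_form_nonneg\<close>).
\<close>

section \<open>Periodic sets of integers and their windows\<close>

definition periodic :: "nat \<Rightarrow> int set \<Rightarrow> bool" where
  "periodic n Q \<longleftrightarrow> (\<forall>z. z + int n \<in> Q \<longleftrightarrow> z \<in> Q)"

definition win :: "int set \<Rightarrow> nat \<Rightarrow> int \<Rightarrow> nat" where
  "win Q m x = card (Q \<inter> {x..<x + int m})"

lemma periodic_mult:
  fixes f :: "int \<Rightarrow> 'a"
  assumes "\<And>z. f (z + int n) = f z"
  shows "f (z + int n * k) = f z"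
proof (induction k rule: int_induct[where k = 0])
  case (step1 i)
  then show ?case using assms[of "z + int n * i"] by (simp add: algebra_simps)
next
  case (step2 i)
  then show ?case using assms[of "z + int n * (i - 1)"] by (simp add: algebra_simps)
qed simp

lemma periodic_reduce:
  fixes f :: "int \<Rightarrow> 'a"
  assumes "\<And>z. f (z + int n) = f z"
  shows "f (b + (z - b) mod int n) = f z"
proof -
  have "b + (z - b) mod int n + int n * ((z - b) div int n) = z"
    by (simp add: algebra_simps)
  then show ?thesis using periodic_mult[of f n "b + (z - b) mod int n" "(z - b) div int n", OF assms]
    by simp
qed

lemma periodic_sum:
  fixes h :: "int \<Rightarrow> 'a::comm_monoid_add"
  assumes "\<And>z. h (z + int n) = h z"
  shows "sum h {a..<a + int n} = sum h {b..<b + int n}"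
proof -
  have step: "sum h {c + 1..<c + 1 + int n} = sum h {c..<c + int n}" for c
  proof (cases "n = 0")
    case False
    then have "{c..<c + int n} = insert c {c + 1..<c + int n}"
      and "{c + 1..<c + 1 + int n} = insert (c + int n) {c + 1..<c + int n}" by auto
    then show ?thesis by (simp add: assms)
  qed simp
  have "sum h {c..<c + int n} = sum h {0..<0 + int n}" for c
  proof (induction c rule: int_induct[where k = 0])
    case (step1 i)
    then show ?case using step[of i] by simp
  next
    case (step2 i)
    then show ?case using step[of "i - 1"] by simp
  qed simp
  from this[of a] this[of b] show ?thesis by simp
qed

lemma card_periodic_shift:
  assumes "periodic n Q"
  shows "card (Q \<inter> {x + int n..<y + int n}) = card (Q \<inter> {x..<y})"
proof -
  have "(\<lambda>z. z + int n) ` (Q \<inter> {x..<y}) = Q \<inter> {x + int n..<y + int n}"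
  proof (intro equalityI subsetI)
    fix z assume z: "z \<in> Q \<inter> {x + int n..<y + int n}"
    then have "z - int n \<in> Q" using assms[unfolded periodic_def, rule_format, of "z - int n"] by simp
    then show "z \<in> (\<lambda>z. z + int n) ` (Q \<inter> {x..<y})" using z
      by (intro image_eqI[where x = "z - int n"]) auto
  qed (use assms in \<open>auto simp: periodic_def\<close>)
  then show ?thesis by (metis (no_types, lifting) card_image inj_on_def add_right_cancel)
qed

lemma win_periodic:
  assumes "periodic n Q"
  shows "win Q m (x + int n) = win Q m x"
  using card_periodic_shift[OF assms, of x "x + int m"] by (simp add: win_def algebra_simps)

lemma sum_of_bool_window:
  "(\<Sum>z\<in>{x..<y}. of_bool (z \<in> Q)) = card (Q \<inter> {x..<y})" for x y :: int
  by (simp add: Int_commute Int_def)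

lemma win_full:
  assumes "periodic n Q"
  shows "win Q n x = win Q n b"
proof -
  have "(\<Sum>z\<in>{x..<x + int n}. of_bool (z \<in> Q)) = (\<Sum>z\<in>{b..<b + int n}. of_bool (z \<in> Q) :: nat)"
    by (rule periodic_sum) (use assms in \<open>simp add: periodic_def\<close>)
  then show ?thesis by (simp add: win_def sum_of_bool_window)
qed

text \<open>An element has at least \<open>t\<close> predecessors precisely when it is not among the first
  \<open>t\<close>; this turns the truncated subtraction \<open>card W - t\<close> into an honest count.\<close>

lemma card_rank:
  fixes W :: "'a::linorder set"
  assumes "finite W"
  shows "card {a \<in> W. t \<le> card (W \<inter> {..<a})} = card W - t"
  using assms
proof (induction W rule: finite_linorder_max_induct)
  case (insert b W)
  have 1: "insert b W \<inter> {..<a} = W \<inter> {..<a}" if "a \<in> W" for a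
    using insert(2) that by force
  have 2: "insert b W \<inter> {..<b} = W" using insert(2) by auto
  have "{a \<in> insert b W. t \<le> card (insert b W \<inter> {..<a})}
      = {a \<in> W. t \<le> card (W \<inter> {..<a})} \<union> (if t \<le> card W then {b} else {})"
    using 1 2 by auto
  moreover have "b \<notin> W" using insert(2) by auto
  ultimately show ?case using insert by auto
qed simp

text \<open>Double counting. Each excess \<open>win Q m x - t\<close> counts the points of the window that are preceded
  by at least \<open>t\<close> others inside it; grouping these incidences by the point \<open>a = x + j\<close> instead of by the
  left end \<open>x\<close> is a shift of a periodic sum.\<close>

lemma excess_sum:
  assumes "periodic n Q"
  shows "(\<Sum>x\<in>{b..<b + int n}. win Q m x - t)
       = (\<Sum>a\<in>Q \<inter> {b..<b + int n}. card {j. j < m \<and> t \<le> card (Q \<inter> {a - int j..<a})})"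
proof -
  define h :: "nat \<Rightarrow> int \<Rightarrow> nat" where
    "h j a = of_bool (a \<in> Q \<and> t \<le> card (Q \<inter> {a - int j..<a}))" for j a
  have h_per: "h j (a + int n) = h j a" for j a
    using assms card_periodic_shift[OF assms, of "a - int j" a]
    by (simp add: h_def periodic_def algebra_simps)
  have row: "win Q m x - t = (\<Sum>j<m. h j (x + int j))" for x
  proof -
    let ?W = "Q \<inter> {x..<x + int m}"
    let ?J = "{j. j < m \<and> x + int j \<in> Q \<and> t \<le> card (Q \<inter> {x..<x + int j})}"
    have sub: "?W \<inter> {..<x + int j} = Q \<inter> {x..<x + int j}" if "j < m" for j
      using that by auto
    have "{a \<in> ?W. t \<le> card (?W \<inter> {..<a})} = (\<lambda>j. x + int j) ` ?J"
    proof (intro equalityI subsetI)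
      fix a assume a: "a \<in> {a \<in> ?W. t \<le> card (?W \<inter> {..<a})}"
      then obtain j where j: "a = x + int j" by (auto dest: zle_iff_zadd[THEN iffD1])
      then have "j < m" using a by auto
      then show "a \<in> (\<lambda>j. x + int j) ` ?J" using a j sub[of j] by auto
    qed (use sub in auto)
    then have "card {a \<in> ?W. t \<le> card (?W \<inter> {..<a})} = card ?J"
      by (simp add: card_image inj_on_def)
    moreover have "(\<Sum>j<m. h j (x + int j)) = card ?J"
      by (simp add: h_def Int_def)
    ultimately show ?thesis using card_rank[of ?W t] by (simp add: win_def)
  qed
  have col: "(\<Sum>x\<in>{b..<b + int n}. h j (x + int j)) = (\<Sum>a\<in>{b..<b + int n}. h j a)" for j
  proof -
    have "(\<Sum>x\<in>{b..<b + int n}. h j (x + int j)) = (\<Sum>a\<in>{b + int j..<b + int j + int n}. h j a)"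
      by (rule sum.reindex_bij_witness[where i = "\<lambda>a. a - int j" and j = "\<lambda>x. x + int j"]) auto
    also have "\<dots> = (\<Sum>a\<in>{b..<b + int n}. h j a)" by (rule periodic_sum) (rule h_per)
    finally show ?thesis .
  qed
  have "(\<Sum>x\<in>{b..<b + int n}. win Q m x - t) = (\<Sum>j<m. \<Sum>a\<in>{b..<b + int n}. h j a)"
    unfolding row by (subst sum.swap) (simp add: col)
  also have "\<dots> = (\<Sum>a\<in>{b..<b + int n}. \<Sum>j<m. h j a)" by (rule sum.swap)
  also have "\<dots> = (\<Sum>a\<in>Q \<inter> {b..<b + int n}. \<Sum>j<m. h j a)"
    by (rule sum.mono_neutral_right) (auto simp: h_def)
  also have "\<dots> = (\<Sum>a\<in>Q \<inter> {b..<b + int n}. card {j. j < m \<and> t \<le> card (Q \<inter> {a - int j..<a})})"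
    by (rule sum.cong) (auto simp: h_def Int_def)
  finally show ?thesis .
qed

text \<open>The distance from \<open>a\<close> back to the \<open>t\<close>-th element of \<open>Q\<close> below it. Since the count
  only grows with \<open>j\<close>, the right-hand side of the double count becomes \<open>\<Sum>a. m - reach Q t a\<close>.\<close>

definition reach :: "int set \<Rightarrow> nat \<Rightarrow> int \<Rightarrow> nat" where
  "reach Q t a = (LEAST j. t \<le> card (Q \<inter> {a - int j..<a}))"

context
  fixes n q t :: nat and Q :: "int set" and b :: int
  assumes per: "periodic n Q" and card_q: "win Q n b = q" and tq: "t \<le> q"
begin

lemma q_le_n: "q \<le> n"
proof -
  have "card (Q \<inter> {b..<b + int n}) \<le> card {b..<b + int n}" by (rule card_mono) auto
  then show ?thesis using card_q by (simp add: win_def)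
qed

text \<open>At most \<open>n - q\<close> points of a period are missing from \<open>Q\<close>, so \<open>n - q + t\<close> steps meet at
  least \<open>t\<close> elements.\<close>

lemma reach_witness: "t \<le> card (Q \<inter> {a - int (n - q + t)..<a})"
proof -
  let ?j = "n - q + t"
  have j: "?j \<le> n" using q_le_n tq by simp
  have "q = card (Q \<inter> {a - int n..<a})"
    using win_full[OF per, of "a - int n" b] card_q by (simp add: win_def)
  also have "Q \<inter> {a - int n..<a} = (Q \<inter> {a - int n..<a - int ?j}) \<union> (Q \<inter> {a - int ?j..<a})"
    using j by auto
  also have "card \<dots> \<le> card (Q \<inter> {a - int n..<a - int ?j}) + card (Q \<inter> {a - int ?j..<a})"
    by (rule card_Un_le)
  also have "card (Q \<inter> {a - int n..<a - int ?j}) \<le> card {a - int n..<a - int ?j}"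
    by (rule card_mono) auto
  also have "\<dots> = n - ?j" using j by simp
  finally show ?thesis using q_le_n tq by linarith
qed

lemma reach_le: "reach Q t a \<le> n - q + t"
  unfolding reach_def by (rule Least_le) (rule reach_witness)

lemma reach_iff: "t \<le> card (Q \<inter> {a - int j..<a}) \<longleftrightarrow> reach Q t a \<le> j"
proof
  assume "reach Q t a \<le> j"
  then have "card (Q \<inter> {a - int (reach Q t a)..<a}) \<le> card (Q \<inter> {a - int j..<a})"
    by (intro card_mono) auto
  moreover have "t \<le> card (Q \<inter> {a - int (reach Q t a)..<a})"
    unfolding reach_def by (rule LeastI) (rule reach_witness)
  ultimately show "t \<le> card (Q \<inter> {a - int j..<a})" by simp
qed (simp add: reach_def Least_le)

lemma reach_ge: "t \<le> reach Q t a"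
proof -
  have "t \<le> card (Q \<inter> {a - int (reach Q t a)..<a})" by (simp add: reach_iff)
  also have "\<dots> \<le> card {a - int (reach Q t a)..<a}" by (rule card_mono) auto
  finally show ?thesis by simp
qed

lemma excess_sum_reach:
  "(\<Sum>x\<in>{b..<b + int n}. win Q m x - t) = (\<Sum>a\<in>Q \<inter> {b..<b + int n}. m - reach Q t a)"
proof -
  have "{j. j < m \<and> reach Q t a \<le> j} = {reach Q t a..<m}" for a by auto
  then show ?thesis by (simp add: excess_sum[OF per] reach_iff)
qed

text \<open>The instance \<open>m = n\<close> of the double count, where every window is a full period and so
  contains exactly \<open>q\<close> points, determines the total of all distances.\<close>

lemma sum_reach: "(\<Sum>a\<in>Q \<inter> {b..<b + int n}. int (reach Q t a)) = int t * int n"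
proof -
  have "(\<Sum>x\<in>{b..<b + int n}. win Q n x - t) = n * (q - t)"
    using win_full[OF per, of _ b] by (simp add: card_q)
  then have "int (\<Sum>a\<in>Q \<inter> {b..<b + int n}. n - reach Q t a) = int (n * (q - t))"
    by (simp add: excess_sum_reach)
  moreover have "int (n - reach Q t a) = int n - int (reach Q t a)" for a
    using reach_le[of a] q_le_n tq by simp
  ultimately have "int q * int n - (\<Sum>a\<in>Q \<inter> {b..<b + int n}. int (reach Q t a)) = int n * (int q - int t)"
    using card_q tq by (simp add: sum_subtractf win_def of_nat_diff)
  then show ?thesis by (simp add: algebra_simps)
qed

text \<open>The total excess is a sum of values of the convex function \<open>g \<mapsto> max 0 (m - g)\<close> at \<open>q\<close> numbers in
  \<open>{t..n - q + t}\<close> whose sum is \<open>t * n\<close>. It is therefore largest when all of them sit at the ends of that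
  interval, which forces \<open>t\<close> of them to be \<open>n - q + t\<close> and the others to be \<open>t\<close>. For \<open>q = n\<close> the interval
  is a single point and one of the first two cases applies, so no division by \<open>n - q\<close> occurs.\<close>

lemma excess_le:
  "(\<Sum>x\<in>{b..<b + int n}. win Q m x - t) \<le> (q - t) * (m - t) + t * (m - (n - q + t))"
proof -
  let ?I = "Q \<inter> {b..<b + int n}" and ?G = "reach Q t"
  have cI: "card ?I = q" using card_q by (simp add: win_def)
  consider "m \<le> t" | "n - q + t \<le> m" | "t < m" "m < n - q + t" by linarith
  then have "(\<Sum>a\<in>?I. m - ?G a) \<le> (q - t) * (m - t) + t * (m - (n - q + t))"
  proof cases
    case 1
    then have "m - ?G a = 0" for a using reach_ge[of a] by simp
    then show ?thesis by simp
  next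
    case 2
    have "int (m - ?G a) = int m - int (?G a)" for a using 2 reach_le[of a] by simp
    then have "int (\<Sum>a\<in>?I. m - ?G a) = int q * int m - int t * int n"
      by (simp add: sum_subtractf cI sum_reach)
    also have "\<dots> = (int q - int t) * (int m - int t) + int t * (int m - int n + int q - int t)"
      by (simp add: algebra_simps)
    also have "\<dots> = int (q - t) * int (m - t) + int t * int (m - (n - q + t))"
      using 2 tq q_le_n by simp
    finally show ?thesis by (simp only: flip: of_nat_mult of_nat_add of_nat_eq_iff)
  next
    case 3
    define d where "d = n - q"
    have d: "int n = int d + int q" "0 < d" using 3 q_le_n by (auto simp: d_def)
    \<comment> \<open>the chord of the convex function over the interval from \<open>t\<close> to \<open>d + t\<close>\<close>
    have "int d * int (m - ?G a) \<le> (int m - int t) * (int d + int t - int (?G a))" for a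
    proof (cases "?G a \<le> m")
      case True
      have "0 \<le> (int (?G a) - int t) * (int d + int t - int m)"
        using reach_ge[of a] 3 by (intro mult_nonneg_nonneg) (auto simp: d_def)
      then show ?thesis using True by (simp add: of_nat_diff algebra_simps)
    next
      case False
      then show ?thesis using 3 reach_le[of a] by (auto simp: d_def intro!: mult_nonneg_nonneg)
    qed
    then have "(\<Sum>a\<in>?I. int d * int (m - ?G a))
        \<le> (\<Sum>a\<in>?I. (int m - int t) * (int d + int t - int (?G a)))" by (rule sum_mono)
    also have "\<dots> = (int m - int t) * (int q * (int d + int t) - int t * int n)"
      by (simp add: sum_reach cI sum_subtractf flip: sum_distrib_left)
    also have "\<dots> = int d * ((int q - int t) * (int m - int t))" by (simp add: d algebra_simps)
    finally have "int d * int (\<Sum>a\<in>?I. m - ?G a) \<le> int d * int ((q - t) * (m - t))"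
      using 3 tq by (simp add: sum_distrib_left of_nat_diff)
    then have "(\<Sum>a\<in>?I. m - ?G a) \<le> (q - t) * (m - t)" using d(2) by (simp only: of_nat_le_iff mult_le_cancel_left_pos of_nat_0_less_iff)
    then show ?thesis by simp
  qed
  then show ?thesis by (simp add: excess_sum_reach)
qed

end

section \<open>Arcs\<close>

definition arc :: "nat \<Rightarrow> int \<Rightarrow> nat \<Rightarrow> int set" where
  "arc n s q = {z. (z - s) mod int n < int q}"

lemma periodic_arc: "periodic n (arc n s q)"
proof -
  have "(z + int n - s) mod int n = (z - s) mod int n" for z
    by (metis add.commute add_diff_eq mod_add_self1)
  then show ?thesis by (simp add: periodic_def arc_def)
qed

lemma arcI: "s \<le> z \<Longrightarrow> z < s + int q \<Longrightarrow> q \<le> n \<Longrightarrow> z \<in> arc n s q"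
  by (simp add: arc_def)

lemma arcD:
  assumes "z \<in> arc n s q" "s - int n \<le> z" "z < s + int n"
  shows "s \<le> z \<and> z < s + int q \<or> z < s + int q - int n"
proof (cases "s \<le> z")
  case True
  then show ?thesis using assms by (simp add: arc_def)
next
  case False
  have "(z - s) mod int n = (z - s + int n) mod int n" by simp
  also have "\<dots> = z - s + int n" using False assms by (intro mod_pos_pos_trivial) auto
  finally show ?thesis using assms by (simp add: arc_def)
qed

lemma arc_Int_window:
  assumes "q \<le> n"
  shows "arc n s q \<inter> {s..<s + int n} = {s..<s + int q}"
proof -
  have "z < s + int q" if "z \<in> arc n s q" "s \<le> z" "z < s + int n" for z
    using arcD[OF that(1)] that by auto
  then show ?thesis using assms arcI[of s _ q n] by auto
qed

lemma win_arc: "q \<le> n \<Longrightarrow> win (arc n s q) n b = q"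
  using win_full[OF periodic_arc, of n s q b s] by (simp add: win_def arc_Int_window)

text \<open>An arc attains the bound: all but its first \<open>t\<close> points see \<open>t\<close> elements of the arc
  immediately below them, and the first \<open>t\<close> points have to look across the gap.\<close>

lemma excess_arc_ge:
  assumes "q \<le> n" "t \<le> q"
  shows "(q - t) * (m - t) + t * (m - (n - q + t))
       \<le> (\<Sum>x\<in>{s..<s + int n}. win (arc n s q) m x - t)"
proof -
  let ?Q = "arc n s q"
  note ctx = periodic_arc[of n s q] win_arc[OF assms(1), of s s] assms(2)
  have 1: "reach ?Q t a \<le> t" if "a \<in> {s + int t..<s + int q}" for a
  proof -
    have "{a - int t..<a} \<subseteq> ?Q" using that assms by (auto intro!: arcI)
    then have "card (?Q \<inter> {a - int t..<a}) = t" by (simp add: Int_absorb1)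
    then show ?thesis using reach_iff[OF ctx, where j = t and a = a] by simp
  qed
  have "(q - t) * (m - t) + t * (m - (n - q + t))
      = (\<Sum>a\<in>{s..<s + int t}. m - (n - q + t)) + (\<Sum>a\<in>{s + int t..<s + int q}. m - t)"
    using assms by (simp add: nat_diff_distrib)
  also have "\<dots> \<le> (\<Sum>a\<in>{s..<s + int t}. m - reach ?Q t a) + (\<Sum>a\<in>{s + int t..<s + int q}. m - reach ?Q t a)"
    using 1 reach_le[OF ctx] by (intro add_mono sum_mono diff_le_mono2) auto
  also have "\<dots> = (\<Sum>a\<in>{s..<s + int t} \<union> {s + int t..<s + int q}. m - reach ?Q t a)"
    by (rule sum.union_disjoint[symmetric]) auto
  also have "{s..<s + int t} \<union> {s + int t..<s + int q} = ?Q \<inter> {s..<s + int n}"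
    using assms by (auto simp: arc_Int_window)
  finally show ?thesis by (simp add: excess_sum_reach[OF ctx])
qed

lemma excess_max_arc:
  assumes "periodic n Q'" "win Q' n b = q" "t \<le> q"
  shows "(\<Sum>x\<in>{b..<b + int n}. win Q' m x - t) \<le> (\<Sum>x\<in>{b..<b + int n}. win (arc n s q) m x - t)"
proof -
  have "(\<Sum>x\<in>{b..<b + int n}. win (arc n s q) m x - t) = (\<Sum>x\<in>{s..<s + int n}. win (arc n s q) m x - t)"
    by (rule periodic_sum) (simp add: win_periodic[OF periodic_arc])
  then show ?thesis
    using excess_le[OF assms, of m] excess_arc_ge[of q n t m s] q_le_n[OF assms] assms(3) by simp
qed

text \<open>A sum over \<open>p\<close> points is at most \<open>p * t\<close> plus the total excess over \<open>t\<close>, with equality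
  when the \<open>p\<close> points form a level set for the threshold \<open>t\<close>. Since the arc maximises the excess for
  every threshold at once, taking \<open>t\<close> as the minimum over \<open>P\<close> compares any pair of sets
  with the arc and one of its level sets.\<close>

lemma window_sum_le:
  assumes P': "periodic n P'" "win P' n b = p" and Q': "periodic n Q'" "win Q' n b = q"
    and P: "periodic n P" "win P n b = p" and m: "m \<le> n"
    and level: "\<And>x y. x \<in> P \<Longrightarrow> y \<notin> P \<Longrightarrow> win (arc n s q) m (y - c) \<le> win (arc n s q) m (x - c)"
  shows "(\<Sum>x\<in>P' \<inter> {b..<b + int n}. win Q' m (x - c))
       \<le> (\<Sum>x\<in>P \<inter> {b..<b + int n}. win (arc n s q) m (x - c))"
proof (cases "P \<inter> {b..<b + int n} = {}")
  case True
  then have "P' \<inter> {b..<b + int n} = {}" using P P' by (simp add: win_def)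
  then show ?thesis by simp
next
  case False
  let ?X = "{b..<b + int n}" and ?Q = "arc n s q"
  define t where "t = Min ((\<lambda>x. win ?Q m (x - c)) ` (P \<inter> ?X))"
  have qn: "q \<le> n" using q_le_n[OF Q' le0] by simp
  have fin: "finite ((\<lambda>x. win ?Q m (x - c)) ` (P \<inter> ?X))" by simp
  have "t \<in> (\<lambda>x. win ?Q m (x - c)) ` (P \<inter> ?X)" unfolding t_def by (rule Min_in[OF fin]) (use False in simp)
  then obtain x0 where x0: "x0 \<in> P" "t = win ?Q m (x0 - c)" by auto
  have t_on: "t \<le> win ?Q m (x - c)" if "x \<in> P \<inter> ?X" for x
    unfolding t_def using that by (intro Min_le[OF fin]) auto
  have t_off: "win ?Q m (x - c) \<le> t" if "x \<notin> P" for x using level[OF x0(1) that] x0(2) by simp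
  have "t \<le> win ?Q n (x0 - c)" unfolding x0(2) win_def using m by (intro card_mono) auto
  then have tq: "t \<le> q" by (simp add: win_arc[OF qn])
  have shift: "(\<Sum>x\<in>?X. win R m (x - c) - t) = (\<Sum>x\<in>?X. win R m x - t)" if "periodic n R" for R
  proof -
    have "(\<Sum>x\<in>?X. win R m (x - c) - t) = (\<Sum>x\<in>{b - c..<b - c + int n}. win R m x - t)"
      by (rule sum.reindex_bij_witness[where i = "\<lambda>a. a + c" and j = "\<lambda>x. x - c"]) auto
    also have "\<dots> = (\<Sum>x\<in>?X. win R m x - t)"
      by (rule periodic_sum) (simp add: win_periodic[OF that])
    finally show ?thesis .
  qed
  have "(\<Sum>x\<in>P' \<inter> ?X. win Q' m (x - c)) \<le> (\<Sum>x\<in>P' \<inter> ?X. t + (win Q' m (x - c) - t))"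
    by (rule sum_mono) simp
  also have "\<dots> = p * t + (\<Sum>x\<in>P' \<inter> ?X. win Q' m (x - c) - t)"
    using P' by (simp add: sum.distrib win_def)
  also have "(\<Sum>x\<in>P' \<inter> ?X. win Q' m (x - c) - t) \<le> (\<Sum>x\<in>?X. win Q' m (x - c) - t)"
    by (rule sum_mono2) auto
  also have "\<dots> \<le> (\<Sum>x\<in>?X. win ?Q m (x - c) - t)"
    unfolding shift[OF Q'(1)] shift[OF periodic_arc] by (rule excess_max_arc[OF Q' tq])
  also have "\<dots> = (\<Sum>x\<in>P \<inter> ?X. win ?Q m (x - c) - t)"
    using t_off by (intro sum.mono_neutral_right) auto
  also have "p * t + \<dots> = (\<Sum>x\<in>P \<inter> ?X. t + (win ?Q m (x - c) - t))"
    using P by (simp add: sum.distrib win_def)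
  also have "\<dots> = (\<Sum>x\<in>P \<inter> ?X. win ?Q m (x - c))"
    using t_on by (intro sum.cong) auto
  finally show ?thesis by simp
qed

text \<open>Moving the window by one loses \<open>x - r\<close> and gains \<open>x + r + 1\<close>. These two points are mirror images
  about \<open>x + 1/2\<close>, and when the window moves towards the centre of the arc the gained point is at least as
  close to the centre as the lost one.\<close>

lemma win_arc_step:
  assumes "q \<le> n" "2 * r + 1 < n"
    and "int q - 2 - int n \<le> 2 * (x - s)" "2 * (x - s) \<le> int q - 2"
  shows "win (arc n s q) (2 * r + 1) (x - int r) \<le> win (arc n s q) (2 * r + 1) (x + 1 - int r)"
proof -
  let ?Q = "arc n s q" and ?C = "{x - int r + 1..<x + int r + 1}"
  have entering: "x + int r + 1 \<in> ?Q" if "x - int r \<in> ?Q"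
    using arcD[OF that] assms by (intro arcI) auto
  have "{x - int r..<x - int r + int (2 * r + 1)} = insert (x - int r) ?C"
    and "{x + 1 - int r..<x + 1 - int r + int (2 * r + 1)} = insert (x + int r + 1) ?C" by auto
  then show ?thesis using entering by (simp add: win_def Int_insert_right card_insert_if)
qed

lemma win_arc_reflect:
  assumes "q \<le> n" "0 < n"
  shows "win (arc n s q) (2 * r + 1) (2 * s + int q - 1 - x - int r)
       = win (arc n s q) (2 * r + 1) (x - int r)"
proof -
  let ?Q = "arc n s q" and ?f = "\<lambda>z. 2 * s + int q - 1 - z"
  have refl: "?f z \<in> ?Q" if "z \<in> ?Q" for z
  proof -
    let ?v = "(z - s) mod int n"
    have v: "?v < int q" using that by (simp add: arc_def)
    then have v0: "0 \<le> ?v" using assms by simp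
    have "(?f z - s) mod int n = (int q - 1 - (z - s)) mod int n" by (simp add: algebra_simps)
    also have "\<dots> = (int q - 1 - ?v) mod int n" by (simp add: mod_diff_right_eq)
    also have "\<dots> = int q - 1 - ?v" using v v0 assms by (intro mod_pos_pos_trivial) linarith+
    finally show ?thesis using v0 by (simp add: arc_def)
  qed
  have "?Q \<inter> {?f x - int r..<?f x - int r + int (2 * r + 1)}
      = ?f ` (?Q \<inter> {x - int r..<x - int r + int (2 * r + 1)})"
  proof (intro equalityI subsetI)
    fix z assume "z \<in> ?Q \<inter> {?f x - int r..<?f x - int r + int (2 * r + 1)}"
    then show "z \<in> ?f ` (?Q \<inter> {x - int r..<x - int r + int (2 * r + 1)})"
      using refl[of z] by (intro image_eqI[where x = "?f z"]) auto
  qed (use refl in auto)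
  then show ?thesis by (simp add: win_def card_image inj_on_def)
qed

lemma win_arc_mono_left:
  assumes "q \<le> n" "2 * r + 1 < n" "y \<le> x"
    and "int q - 1 - int n \<le> 2 * (y - s)" "2 * (x - s) \<le> int q - 1"
  shows "win (arc n s q) (2 * r + 1) (y - int r) \<le> win (arc n s q) (2 * r + 1) (x - int r)"
  using assms(3,5)
proof (induction x rule: int_ge_induct)
  case (step x)
  have "win (arc n s q) (2 * r + 1) (x - int r) \<le> win (arc n s q) (2 * r + 1) (x + 1 - int r)"
    using step assms by (intro win_arc_step) auto
  then show ?case using step by simp
qed simp

text \<open>Doubled coordinates avoid the half-integral centre \<open>s + (q - 1) / 2\<close> of the arc: the
  hypotheses compare distances from that centre, within half a turn.\<close>

lemma win_arc_antimono:
  assumes qn: "q \<le> n" "2 * r + 1 < n"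
    and xy: "\<bar>2 * (x - s) - (int q - 1)\<bar> \<le> \<bar>2 * (y - s) - (int q - 1)\<bar>"
    and y: "\<bar>2 * (y - s) - (int q - 1)\<bar> \<le> int n"
  shows "win (arc n s q) (2 * r + 1) (y - int r) \<le> win (arc n s q) (2 * r + 1) (x - int r)"
proof -
  define left where "left z = (if 2 * (z - s) \<le> int q - 1 then z else 2 * s + int q - 1 - z)" for z
  have "win (arc n s q) (2 * r + 1) (left z - int r) = win (arc n s q) (2 * r + 1) (z - int r)" for z
    using win_arc_reflect[OF qn(1), of s r z] qn(2) by (simp add: left_def)
  moreover have "win (arc n s q) (2 * r + 1) (left y - int r) \<le> win (arc n s q) (2 * r + 1) (left x - int r)"
    by (rule win_arc_mono_left[OF qn]) (use xy y in \<open>auto simp: left_def\<close>)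
  ultimately show ?thesis by simp
qed

text \<open>An arc \<open>P\<close> inside \<open>Q\<close> whose margins \<open>l\<close> and \<open>k\<close> differ by at most one is a set of nearest points
  to the centre of \<open>Q\<close>, hence a level set of the window counts.\<close>

lemma win_arc_level:
  assumes q: "q = l + p + k" "q \<le> n" "l \<le> k + 1" "k \<le> l + 1" and r: "2 * r + 1 < n"
    and x: "x \<in> arc n (s + int l) p" and y: "y \<notin> arc n (s + int l) p"
  shows "win (arc n s q) (2 * r + 1) (y - int r) \<le> win (arc n s q) (2 * r + 1) (x - int r)"
proof -
  let ?P = "arc n (s + int l) p" and ?h = "\<lambda>x. win (arc n s q) (2 * r + 1) (x - int r)"
  have h_per: "?h (z + int n) = ?h z" for z
    using win_periodic[OF periodic_arc, of n s q "2 * r + 1" "z - int r"] by (simp add: algebra_simps)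
  have P_per: "(z + int n \<in> ?P) = (z \<in> ?P)" for z using periodic_arc by (simp add: periodic_def)
  define x' where "x' = s + int l + (x - (s + int l)) mod int n"
  \<comment> \<open>the left end of a period that is centred at the centre of \<open>Q\<close>\<close>
  define L where "L = s + (int q - int n) div 2"
  define y' where "y' = L + (y - L) mod int n"
  have hx: "?h x' = ?h x" and hy: "?h y' = ?h y"
    unfolding x'_def y'_def by (rule periodic_reduce[of ?h, OF h_per])+
  have "(y' \<in> ?P) = (y \<in> ?P)" unfolding y'_def
    by (rule periodic_reduce[of "\<lambda>z. z \<in> ?P", OF P_per])
  then have "y' \<notin> ?P" using y by simp
  then have y'_off: "y' < s + int l \<or> s + int l + int p \<le> y'"
    using arcI[of "s + int l" y' p n] q by linarith
  have x'_on: "s + int l \<le> x'" "x' < s + int l + int p"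
    using x r by (auto simp: x'_def arc_def)
  have y'_range: "L \<le> y'" "y' \<le> L + int n - 1"
    using r pos_mod_bound[of "int n" "y - L"] by (auto simp: y'_def)
  have L: "int q - 1 - int n \<le> 2 * (L - s)" "2 * (L - s) \<le> int q - int n"
    by (auto simp: L_def)
  define X Y where "X = 2 * (x' - s) - (int q - 1)" and "Y = 2 * (y' - s) - (int q - 1)"
  have iq: "int q = int l + int p + int k" "int l - int k \<le> 1" "int k - int l \<le> 1"
    using q by auto
  have X: "int l - int k - int p + 1 \<le> X" "X \<le> int l - int k + int p - 1"
    using x'_on iq(1) by (auto simp: X_def)
  have Y: "Y \<le> int l - int k - int p - 1 \<or> int l - int k + int p + 1 \<le> Y"
    using y'_off iq(1) by (auto simp: Y_def)
  have "\<bar>X\<bar> \<le> \<bar>Y\<bar>" using X Y iq(2,3) by linarith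
  moreover have "\<bar>Y\<bar> \<le> int n" using y'_range L by (simp add: Y_def abs_le_iff)
  ultimately have "?h y' \<le> ?h x'"
    unfolding X_def Y_def by (rule win_arc_antimono[OF q(2) r])
  then show ?thesis using hx hy by simp
qed

section \<open>The rearrangement inequality on the cycle\<close>

definition cyc_dist :: "nat \<Rightarrow> int \<Rightarrow> int \<Rightarrow> nat" where
  "cyc_dist n x y = nat (min ((x - y) mod int n) ((y - x) mod int n))"

lemma cyc_dist_self [simp]: "cyc_dist n x x = 0"
  by (simp add: cyc_dist_def)

lemma cyc_dist_commute: "cyc_dist n x y = cyc_dist n y x"
  by (simp add: cyc_dist_def min.commute)

lemma cyc_dist_le:
  assumes "0 < n" shows "cyc_dist n x y \<le> n div 2"
proof (cases "(x - y) mod int n = 0")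
  case False
  then have "(y - x) mod int n = int n - (x - y) mod int n"
    using zmod_zminus1_eq_if[of "x - y" "int n"] by simp
  then show ?thesis unfolding cyc_dist_def by linarith
qed (simp add: cyc_dist_def)

lemma cyc_dist_periodic: "cyc_dist n x (y + int n) = cyc_dist n x y"
proof -
  have "(x - (y + int n)) mod int n = (x - y) mod int n" "(y + int n - x) mod int n = (y - x) mod int n"
    by (metis diff_diff_add minus_mod_self2, metis add.commute add_diff_eq mod_add_self1)
  then show ?thesis by (simp add: cyc_dist_def)
qed

lemma cyc_dist_window:
  assumes "2 * r + 1 < n" "x - int r \<le> z" "z < x - int r + int n"
  shows "cyc_dist n x z \<le> r \<longleftrightarrow> z < x - int r + int (2 * r + 1)"
proof (cases "z \<le> x")
  case True
  then have "(x - z) mod int n = x - z" using assms by (intro mod_pos_pos_trivial) auto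
  then show ?thesis using assms True by (auto simp: cyc_dist_def)
next
  case False
  then have "(z - x) mod int n = z - x" using assms by (intro mod_pos_pos_trivial) auto
  moreover from this have "(x - z) mod int n = int n - (z - x)"
    using zmod_zminus1_eq_if[of "z - x" "int n"] False assms by simp
  ultimately show ?thesis using assms False by (auto simp: cyc_dist_def)
qed

lemma count_near:
  assumes "periodic n Q" "2 * r + 1 < n"
  shows "(\<Sum>y\<in>Q \<inter> {b..<b + int n}. of_bool (cyc_dist n x y \<le> r)) = win Q (2 * r + 1) (x - int r)"
proof -
  let ?h = "\<lambda>y. of_bool (y \<in> Q \<and> cyc_dist n x y \<le> r) :: nat"
  let ?c = "x - int r"
  have "(\<Sum>y\<in>Q \<inter> {b..<b + int n}. of_bool (cyc_dist n x y \<le> r)) = sum ?h {b..<b + int n}"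
    by (rule sum.mono_neutral_cong_left) auto
  also have "\<dots> = sum ?h {?c..<?c + int n}"
    by (rule periodic_sum) (use assms in \<open>simp add: cyc_dist_periodic periodic_def\<close>)
  also have "\<dots> = card {y \<in> {?c..<?c + int n}. y \<in> Q \<and> cyc_dist n x y \<le> r}"
    by (simp add: Int_def)
  also have "{y \<in> {?c..<?c + int n}. y \<in> Q \<and> cyc_dist n x y \<le> r} = Q \<inter> {?c..<?c + int (2 * r + 1)}"
    using cyc_dist_window[OF assms(2), of x] assms(2) by auto
  finally show ?thesis by (simp add: win_def)
qed

text \<open>The indicator of \<open>d \<le> r\<close> selects exactly the terms with \<open>r \<ge> d\<close>, and these telescope.\<close>

lemma layer_cake:
  fixes \<phi> :: "nat \<Rightarrow> real"
  assumes "d \<le> h"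
  shows "\<phi> d = \<phi> h + (\<Sum>r<h. (\<phi> r - \<phi> (Suc r)) * of_bool (d \<le> r))"
proof -
  have "(\<Sum>r<h. (\<phi> r - \<phi> (Suc r)) * of_bool (d \<le> r)) = (\<Sum>r\<in>{d..<h}. \<phi> r - \<phi> (Suc r))"
    by (rule sum.mono_neutral_cong_right) auto
  also have "\<dots> = \<phi> d - \<phi> h"
    using sum_Suc_diff'[OF assms, of "\<lambda>r. - \<phi> r"] by simp
  finally show ?thesis by simp
qed

lemma pair_sum_layers:
  fixes \<phi> :: "nat \<Rightarrow> real"
  assumes "0 < n" and Q: "periodic n Q" "win Q n b = q" and P: "win P n b = p"
  shows "(\<Sum>x\<in>P \<inter> {b..<b + int n}. \<Sum>y\<in>Q \<inter> {b..<b + int n}. \<phi> (cyc_dist n x y))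
    = real p * real q * \<phi> (n div 2) + (\<Sum>r<n div 2. (\<phi> r - \<phi> (Suc r)) *
        real (\<Sum>x\<in>P \<inter> {b..<b + int n}. win Q (2 * r + 1) (x - int r)))"
proof -
  let ?X = "{b..<b + int n}" and ?h = "n div 2"
  have inner: "(\<Sum>y\<in>Q \<inter> ?X. \<phi> (cyc_dist n x y)) = real q * \<phi> ?h
      + (\<Sum>r<?h. (\<phi> r - \<phi> (Suc r)) * real (win Q (2 * r + 1) (x - int r)))" for x
  proof -
    have "(\<Sum>y\<in>Q \<inter> ?X. \<phi> (cyc_dist n x y)) = (\<Sum>y\<in>Q \<inter> ?X. \<phi> ?h
        + (\<Sum>r<?h. (\<phi> r - \<phi> (Suc r)) * of_bool (cyc_dist n x y \<le> r)))"
      by (intro sum.cong refl layer_cake cyc_dist_le assms)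
    also have "\<dots> = real q * \<phi> ?h
        + (\<Sum>y\<in>Q \<inter> ?X. \<Sum>r<?h. (\<phi> r - \<phi> (Suc r)) * of_bool (cyc_dist n x y \<le> r))"
      using Q by (simp only: sum.distrib win_def sum_constant)
    also have "(\<Sum>y\<in>Q \<inter> ?X. \<Sum>r<?h. (\<phi> r - \<phi> (Suc r)) * of_bool (cyc_dist n x y \<le> r))
        = (\<Sum>r<?h. \<Sum>y\<in>Q \<inter> ?X. (\<phi> r - \<phi> (Suc r)) * of_bool (cyc_dist n x y \<le> r))"
      by (rule sum.swap)
    also have "(\<Sum>r<?h. \<Sum>y\<in>Q \<inter> ?X. (\<phi> r - \<phi> (Suc r)) * of_bool (cyc_dist n x y \<le> r))
        = (\<Sum>r<?h. (\<phi> r - \<phi> (Suc r)) * real (win Q (2 * r + 1) (x - int r)))"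
    proof (rule sum.cong[OF refl])
      fix r assume "r \<in> {..<?h}"
      then have "2 * r + 1 < n" by auto
      from count_near[OF Q(1) this, of x b]
      show "(\<Sum>y\<in>Q \<inter> ?X. (\<phi> r - \<phi> (Suc r)) * of_bool (cyc_dist n x y \<le> r))
          = (\<phi> r - \<phi> (Suc r)) * real (win Q (2 * r + 1) (x - int r))"
        by (simp only: of_nat_of_bool[symmetric, where 'a = real] sum_distrib_left[symmetric] of_nat_sum[symmetric])
    qed
    finally show ?thesis .
  qed
  have "(\<Sum>x\<in>P \<inter> ?X. \<Sum>y\<in>Q \<inter> ?X. \<phi> (cyc_dist n x y)) = real p * (real q * \<phi> ?h)
      + (\<Sum>x\<in>P \<inter> ?X. \<Sum>r<?h. (\<phi> r - \<phi> (Suc r)) * real (win Q (2 * r + 1) (x - int r)))"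
    unfolding inner using P by (simp only: sum.distrib win_def sum_constant)
  also have "(\<Sum>x\<in>P \<inter> ?X. \<Sum>r<?h. (\<phi> r - \<phi> (Suc r)) * real (win Q (2 * r + 1) (x - int r)))
      = (\<Sum>r<?h. (\<phi> r - \<phi> (Suc r)) * real (\<Sum>x\<in>P \<inter> ?X. win Q (2 * r + 1) (x - int r)))"
    by (subst sum.swap) (simp add: sum_distrib_left)
  finally show ?thesis by simp
qed

text \<open>A Riesz-type inequality on the cycle: each layer of \<open>\<phi>\<close> counts the points of \<open>Q\<close> in windows of
  odd length centred at the points of \<open>P\<close>, and concentric arcs are optimal for all layers simultaneously.\<close>

theorem cyclic_rearrangement:
  fixes \<phi> :: "nat \<Rightarrow> real"
  assumes anti: "antimono_on {0..n div 2} \<phi>"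
    and P': "periodic n P'" "win P' n b = p" and Q': "periodic n Q'" "win Q' n b = q"
    and q: "q = l + p + k" "l \<le> k + 1" "k \<le> l + 1" and n: "0 < n"
  shows "(\<Sum>x\<in>P' \<inter> {b..<b + int n}. \<Sum>y\<in>Q' \<inter> {b..<b + int n}. \<phi> (cyc_dist n x y))
    \<le> (\<Sum>x\<in>arc n (s + int l) p \<inter> {b..<b + int n}. \<Sum>y\<in>arc n s q \<inter> {b..<b + int n}. \<phi> (cyc_dist n x y))"
proof -
  have qn: "q \<le> n" using q_le_n[OF Q' le0] by simp
  then have pn: "p \<le> n" using q by simp
  have "(\<phi> r - \<phi> (Suc r)) * real (\<Sum>x\<in>P' \<inter> {b..<b + int n}. win Q' (2 * r + 1) (x - int r))
      \<le> (\<phi> r - \<phi> (Suc r)) * real (\<Sum>x\<in>arc n (s + int l) p \<inter> {b..<b + int n}.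
          win (arc n s q) (2 * r + 1) (x - int r))" if "r < n div 2" for r
  proof (intro mult_left_mono of_nat_mono window_sum_le[OF P' Q' periodic_arc win_arc[OF pn]])
    show "0 \<le> \<phi> r - \<phi> (Suc r)" using that monotone_onD[OF anti, of r "Suc r"] by simp
    show "2 * r + 1 \<le> n" using that by simp
    have "2 * r + 1 < n" using that by simp
    then show "win (arc n s q) (2 * r + 1) (y - int r) \<le> win (arc n s q) (2 * r + 1) (x - int r)"
      if "x \<in> arc n (s + int l) p" "y \<notin> arc n (s + int l) p" for x y
      using win_arc_level[OF q(1) qn q(2,3) _ that] by blast
  qed
  then show ?thesis
    unfolding pair_sum_layers[OF n Q' P'(2)]
      pair_sum_layers[OF n periodic_arc win_arc[OF qn] win_arc[OF pn]]
    by (intro add_left_mono sum_mono) auto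
qed

section \<open>Rearrangement by permutations\<close>

definition periodize :: "nat \<Rightarrow> nat set \<Rightarrow> int set" where
  "periodize n X = {z. \<exists>x\<in>X. z mod int n = int x mod int n}"

lemma periodic_periodize: "periodic n (periodize n X)"
  by (simp add: periodic_def periodize_def)

lemma periodize_Int_window:
  assumes "X \<subseteq> {1..n}"
  shows "periodize n X \<inter> {1..<1 + int n} = int ` X"
proof (intro equalityI subsetI)
  fix z assume z: "z \<in> periodize n X \<inter> {1..<1 + int n}"
  then obtain x where x: "x \<in> X" "z mod int n = int x mod int n" by (auto simp: periodize_def)
  have "x \<in> {1..n}" using x assms by auto
  have "(z - 1) mod int n = (int x - 1) mod int n" using x(2) by (metis mod_diff_left_eq)
  moreover have "(z - 1) mod int n = z - 1" using z by (intro mod_pos_pos_trivial) auto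
  moreover have "(int x - 1) mod int n = int x - 1"
    using \<open>x \<in> {1..n}\<close> by (intro mod_pos_pos_trivial) auto
  ultimately show "z \<in> int ` X" using x by auto
qed (use assms in \<open>auto simp: periodize_def\<close>)

text \<open>The two arcs are those of the rearrangement inequality, read inside \<open>{1..n}\<close>; a permutation carries
  them to arbitrary sets of the same sizes.\<close>

lemma permuted_sum_le_arcs:
  fixes \<phi> :: "nat \<Rightarrow> real" and n p q l k :: nat and s :: int
  defines "P \<equiv> {i\<in>{1..n}. int i \<in> arc n (s + int l) p}" and "Q \<equiv> {i\<in>{1..n}. int i \<in> arc n s q}"
  assumes anti: "antimono_on {0..n div 2} \<phi>" and \<rho>: "\<rho> permutes {1..n}"
    and q: "q = l + p + k" "l \<le> k + 1" "k \<le> l + 1" and n: "0 < n" "q \<le> n"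
  shows "(\<Sum>i\<in>P. \<Sum>j\<in>Q. \<phi> (cyc_dist n (int (\<rho> i)) (int (\<rho> j))))
       \<le> (\<Sum>i\<in>P. \<Sum>j\<in>Q. \<phi> (cyc_dist n (int i) (int j)))"
proof -
  let ?X = "{1..<1 + int n}"
  have \<rho>_sub: "\<rho> ` R \<subseteq> {1..n}" if "R \<subseteq> {1..n}" for R
    using permutes_image[OF \<rho>] that by blast
  have inj: "inj_on (\<lambda>i. int (\<rho> i)) R" for R
    using permutes_inj[OF \<rho>] by (auto simp: inj_on_def)
  have window: "periodize n (\<rho> ` R) \<inter> ?X = (\<lambda>i. int (\<rho> i)) ` R" if "R \<subseteq> {1..n}" for R
    using periodize_Int_window[OF \<rho>_sub[OF that]] by (simp add: image_image)
  have arc_window: "arc n c w \<inter> ?X = int ` {i\<in>{1..n}. int i \<in> arc n c w}" for c w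
  proof (intro equalityI subsetI)
    fix z assume "z \<in> arc n c w \<inter> ?X"
    then show "z \<in> int ` {i\<in>{1..n}. int i \<in> arc n c w}"
      by (intro image_eqI[where x = "nat z"]) auto
  qed auto
  have card: "card {i\<in>{1..n}. int i \<in> arc n c w} = w" if "w \<le> n" for c w
    using win_arc[OF that, of c 1] by (simp add: win_def arc_window card_image)
  have sub: "P \<subseteq> {1..n}" "Q \<subseteq> {1..n}" by (auto simp: P_def Q_def)
  have "card P = p" "card Q = q" unfolding P_def Q_def using card n q by simp_all
  then have "win (periodize n (\<rho> ` P)) n 1 = p" "win (periodize n (\<rho> ` Q)) n 1 = q"
    by (simp_all add: win_def window[OF sub(1)] window[OF sub(2)] card_image inj)
  from cyclic_rearrangement[OF anti periodic_periodize this(1) periodic_periodize this(2) q n(1), of s]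
  show ?thesis
    unfolding window[OF sub(1)] window[OF sub(2)] arc_window
    by (simp add: sum.reindex inj P_def Q_def)
qed

section \<open>Kalmanson matrices\<close>

text \<open>The boundary term carries the factor \<open>\<Sum>i=1..n. y i\<close>, which vanishes.\<close>

lemma summation_by_parts:
  fixes x y :: "nat \<Rightarrow> real"
  assumes "(\<Sum>i=1..n. y i) = 0"
  shows "(\<Sum>i=1..n. x i * y i) = (\<Sum>u=1..<n. (\<Sum>i=1..u. y i) * (x u - x (Suc u)))"
proof -
  have "(\<Sum>i=1..n. x i * y i) = (\<Sum>u=1..<n. (\<Sum>i=1..u. y i) * (x u - x (Suc u))) + (\<Sum>i=1..n. y i) * x n"
  proof (induction n)
    case (Suc n)
    then show ?case by (cases "n = 0") (simp_all add: algebra_simps)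
  qed simp
  then show ?thesis using assms by simp
qed

text \<open>Summation by parts in both indices replaces \<open>K\<close> by its mixed differences \<open>\<Delta> u v\<close> and \<open>D\<close> by its
  prefix sums \<open>S u v\<close>. The Kalmanson condition controls \<open>\<Delta> u v\<close> only for \<open>u\<close>, \<open>v\<close> at distance at least two, so write
  \<open>2 * S u v = E u v + S u u + S v v\<close>. Here \<open>- E u v\<close> is the sum of \<open>D\<close> over the square block on
  \<open>{u<..v}\<close>: it vanishes in the uncontrolled cases, because the diagonal of \<open>D\<close> does, and is at most
  zero otherwise. The remaining terms pair \<open>S u u\<close>, again a block sum, with \<open>\<Sum>v. \<Delta> u v\<close>, which telescopes
  to a difference governed by the Kalmanson condition for the indices \<open>1\<close>, \<open>u\<close>, \<open>u + 1\<close>, \<open>n\<close>. In terms of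
  cuts: up to terms on which every \<open>D\<close> with zero row sums and zero diagonal vanishes,
  \<open>K\<close> is a nonnegative combination of cut metrics of arcs.\<close>

lemma kalmanson_form_nonneg:
  fixes D K :: "nat \<Rightarrow> nat \<Rightarrow> real"
  assumes K: "kalmanson n K"
    and sym: "\<And>i j. D i j = D j i" and diag: "\<And>i. D i i = 0"
    and row: "\<And>i. i \<in> {1..n} \<Longrightarrow> (\<Sum>j=1..n. D i j) = 0"
    and arcs: "\<And>u v. u \<le> v \<Longrightarrow> v \<le> n \<Longrightarrow> (\<Sum>i\<in>{u<..v}. \<Sum>j\<in>{u<..v}. D i j) \<le> 0"
  shows "0 \<le> (\<Sum>i=1..n. \<Sum>j=1..n. D i j * K i j)"
proof -
  define S where "S u v = (\<Sum>i=1..u. \<Sum>j=1..v. D i j)" for u v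
  define \<Delta> where "\<Delta> u v = K u v + K (Suc u) (Suc v) - K u (Suc v) - K (Suc u) v" for u v
  define E where "E u v = 2 * S u v - S u u - S v v" for u v
  let ?I = "{1..<n}"
  have K_sym: "K i j = K j i" if "i \<in> {1..n}" "j \<in> {1..n}" for i j
    using K that by (auto simp: kalmanson_def symmetric_mat_def)
  have S_sym: "S u v = S v u" for u v
    unfolding S_def by (subst sum.swap) (simp add: sym)
  have E_sym: "E u v = E v u" for u v by (simp add: E_def S_sym)
  have \<Delta>_sym: "\<Delta> u v = \<Delta> v u" if "u \<in> ?I" "v \<in> ?I" for u v
    using that by (simp add: \<Delta>_def K_sym[of u v] K_sym[of "Suc u" "Suc v"] K_sym[of u "Suc v"] K_sym[of "Suc u" v])
  have block: "(\<Sum>i\<in>{u<..v}. \<Sum>j\<in>{u<..v}. D i j) = - E u v" if "u \<le> v" for u v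
  proof -
    have split: "{1..v} = {1..u} \<union> {u<..v}" "{1..u} \<inter> {u<..v} = {}" using that by auto
    have "(\<Sum>j=1..v. f j) = (\<Sum>j=1..u. f j) + (\<Sum>j\<in>{u<..v}. f j)" for f :: "nat \<Rightarrow> real"
      unfolding split(1) by (rule sum.union_disjoint) (use split(2) in auto)
    then have "S v v = S u v + (\<Sum>i\<in>{u<..v}. \<Sum>j=1..u. D i j) + (\<Sum>i\<in>{u<..v}. \<Sum>j\<in>{u<..v}. D i j)"
      and "S v u = S u u + (\<Sum>i\<in>{u<..v}. \<Sum>j=1..u. D i j)"
      by (simp_all add: S_def sum.distrib)
    then show ?thesis using S_sym[of u v] by (simp add: E_def)
  qed
  have E_nonneg: "0 \<le> E u v" if "u \<le> v" "v \<le> n" for u v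
    using arcs[OF that] block[OF that(1)] by simp
  have E_next: "E u (Suc u) = 0" for u
  proof -
    have "{u<..Suc u} = {Suc u}" by auto
    then show ?thesis using block[of u "Suc u"] by (simp add: diag)
  qed
  have E\<Delta>: "0 \<le> E u v * \<Delta> u v" if uv: "u \<in> ?I" "v \<in> ?I" "u \<le> v" for u v
  proof -
    consider "v = u" | "v = Suc u" | "Suc u < v" using uv by linarith
    then show ?thesis
    proof cases
      case 3
      have "\<forall>i j k l. 1 \<le> i \<and> i < j \<and> j < k \<and> k < l \<and> l \<le> n \<longrightarrow> K i l + K j k \<le> K i k + K j l"
        using K unfolding kalmanson_def by blast
      from this[rule_format, of u "Suc u" v "Suc v"] 3 uv
      have "0 \<le> \<Delta> u v" by (simp add: \<Delta>_def)
      then show ?thesis using E_nonneg[of u v] uv by simp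
    qed (simp_all add: E_next, simp add: E_def)
  qed
  then have E\<Delta>': "0 \<le> E u v * \<Delta> u v" if "u \<in> ?I" "v \<in> ?I" for u v
    by (metis E\<Delta> E_sym \<Delta>_sym nat_le_linear that)
  have S_diag: "S u u * (\<Sum>v\<in>?I. \<Delta> u v) \<ge> 0" if u: "u \<in> ?I" for u
  proof -
    have "{0<..u} = {1..u}" by auto
    then have S_nonpos: "S u u \<le> 0" using arcs[of 0 u] u by (simp add: S_def)
    have telescope: "(\<Sum>v\<in>?I. \<Delta> u v) = K u 1 - K (Suc u) 1 - K u n + K (Suc u) n"
      using sum_Suc_diff'[of 1 n "\<lambda>v. K (Suc u) v - K u v"] u
      by (simp add: \<Delta>_def algebra_simps)
    consider "u = 1" | "Suc u = n" | "1 < u" "Suc u < n" using u by fastforce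
    then show ?thesis
    proof cases
      case 1
      then show ?thesis by (simp add: S_def diag)
    next
      case 2
      have "S n n = 0" "S n u = 0"
        using row unfolding S_sym[of n u] by (simp_all add: S_def 2[symmetric])
      then have "S u u = 0" using E_next[of u] S_sym[of n u] 2 by (simp add: E_def)
      then show ?thesis by simp
    next
      case 3
      have "\<forall>i j k l. 1 \<le> i \<and> i < j \<and> j < k \<and> k < l \<and> l \<le> n \<longrightarrow> K i j + K k l \<le> K i k + K j l"
        using K unfolding kalmanson_def by blast
      from this[rule_format, of 1 u "Suc u" n] 3 u
      moreover have "K 1 u = K u 1" "K 1 (Suc u) = K (Suc u) 1" using u by (auto intro!: K_sym)
      ultimately have "(\<Sum>v\<in>?I. \<Delta> u v) \<le> 0" unfolding telescope by simp
      then show ?thesis using S_nonpos by (simp add: mult_nonpos_nonpos)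
    qed
  qed
  have "(\<Sum>i=1..n. \<Sum>j=1..n. D i j * K i j)
      = (\<Sum>i=1..n. \<Sum>v\<in>?I. (\<Sum>j=1..v. D i j) * (K i v - K i (Suc v)))"
  proof (rule sum.cong[OF refl])
    fix i assume "i \<in> {1..n}"
    then show "(\<Sum>j=1..n. D i j * K i j) = (\<Sum>v\<in>?I. (\<Sum>j=1..v. D i j) * (K i v - K i (Suc v)))"
      using summation_by_parts[OF row, of i "K i"] by (simp add: mult.commute)
  qed
  also have "\<dots> = (\<Sum>v\<in>?I. \<Sum>i=1..n. (K i v - K i (Suc v)) * (\<Sum>j=1..v. D i j))"
    by (subst sum.swap) (simp add: mult.commute)
  also have "\<dots> = (\<Sum>v\<in>?I. \<Sum>u\<in>?I. S u v * \<Delta> u v)"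
  proof (rule sum.cong[OF refl])
    fix v assume "v \<in> ?I"
    have "(\<Sum>i=1..n. \<Sum>j=1..v. D i j) = (\<Sum>j=1..v. \<Sum>i=1..n. D j i)"
      by (subst sum.swap) (simp add: sym)
    also have "\<dots> = 0" using row \<open>v \<in> ?I\<close> by simp
    finally show "(\<Sum>i=1..n. (K i v - K i (Suc v)) * (\<Sum>j=1..v. D i j)) = (\<Sum>u\<in>?I. S u v * \<Delta> u v)"
      using summation_by_parts[of "\<lambda>i. \<Sum>j=1..v. D i j" n "\<lambda>i. K i v - K i (Suc v)"]
      by (simp add: S_def \<Delta>_def algebra_simps)
  qed
  finally have total: "(\<Sum>i=1..n. \<Sum>j=1..n. D i j * K i j) = (\<Sum>v\<in>?I. \<Sum>u\<in>?I. S u v * \<Delta> u v)" .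
  have "2 * (\<Sum>v\<in>?I. \<Sum>u\<in>?I. S u v * \<Delta> u v)
      = (\<Sum>v\<in>?I. \<Sum>u\<in>?I. E u v * \<Delta> u v) + (\<Sum>v\<in>?I. \<Sum>u\<in>?I. S v v * \<Delta> u v)
        + (\<Sum>v\<in>?I. \<Sum>u\<in>?I. S u u * \<Delta> u v)"
    by (simp add: E_def sum_distrib_left algebra_simps flip: sum.distrib)
  also have "(\<Sum>v\<in>?I. \<Sum>u\<in>?I. S u u * \<Delta> u v) = (\<Sum>u\<in>?I. S u u * (\<Sum>v\<in>?I. \<Delta> u v))"
    by (subst sum.swap) (simp add: sum_distrib_left)
  also have "(\<Sum>v\<in>?I. \<Sum>u\<in>?I. S v v * \<Delta> u v) = (\<Sum>v\<in>?I. S v v * (\<Sum>u\<in>?I. \<Delta> v u))"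
    by (simp add: sum_distrib_left \<Delta>_sym)
  finally have "2 * (\<Sum>v\<in>?I. \<Sum>u\<in>?I. S u v * \<Delta> u v)
      = (\<Sum>v\<in>?I. \<Sum>u\<in>?I. E u v * \<Delta> u v) + (\<Sum>v\<in>?I. S v v * (\<Sum>u\<in>?I. \<Delta> v u))
        + (\<Sum>v\<in>?I. S v v * (\<Sum>u\<in>?I. \<Delta> v u))" .
  moreover have "0 \<le> (\<Sum>v\<in>?I. \<Sum>u\<in>?I. E u v * \<Delta> u v)" by (intro sum_nonneg E\<Delta>')
  moreover have "0 \<le> (\<Sum>v\<in>?I. S v v * (\<Sum>u\<in>?I. \<Delta> v u))" by (intro sum_nonneg S_diag)
  ultimately show ?thesis unfolding total by linarith
qed

section \<open>Level sets of the Supnick permutation\<close>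

lemma filter_odd_upt: "filter odd [1..<Suc n] = map (\<lambda>i. 2 * i + 1) [0..<(n + 1) div 2]"
proof (induction n)
  case (Suc n)
  then show ?case by (cases "odd n") (auto elim!: oddE evenE)
qed simp

lemma filter_even_upt: "filter even [1..<Suc n] = map (\<lambda>i. 2 * i + 2) [0..<n div 2]"
proof (induction n)
  case (Suc n)
  then show ?case by (cases "odd n") (auto elim!: oddE evenE)
qed simp

lemma supnick_eq:
  assumes "i \<in> {1..n}"
  shows "supnick n i = (if i \<le> (n + 1) div 2 then 2 * i - 1 else 2 * (n - i) + 2)"
proof -
  let ?evens = "map (\<lambda>i. 2 * i + 2) [0..<n div 2]"
  have "rev ?evens ! (i - 1 - (n + 1) div 2) = 2 * (n - i) + 2" if "\<not> i \<le> (n + 1) div 2"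
  proof -
    have "i - 1 - (n + 1) div 2 < length ?evens" using that assms by simp
    then have "rev ?evens ! (i - 1 - (n + 1) div 2) = ?evens ! (n div 2 - Suc (i - 1 - (n + 1) div 2))"
      by (subst rev_nth) simp_all
    also have "n div 2 - Suc (i - 1 - (n + 1) div 2) = n - i" using that assms by simp
    also have "?evens ! (n - i) = 2 * (n - i) + 2"
    proof -
      have "n - i < n div 2" using that assms by simp
      then show ?thesis by simp
    qed
    finally show ?thesis .
  qed
  then show ?thesis
    using assms unfolding supnick_def one_line_def filter_odd_upt filter_even_upt
    by (auto simp: nth_append)
qed

text \<open>The Supnick permutation is unimodal, so its \<open>p\<close> largest values occupy an interval in the middle.\<close>

lemma supnick_level:
  assumes "i \<in> {1..n}" "p \<le> n"
  shows "n - p + 1 \<le> supnick n i \<longleftrightarrow> (n - p + 1) div 2 < i \<and> i \<le> n - (n - p) div 2"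
proof -
  obtain k where k: "n = k + p" using assms(2) by (metis le_add_diff_inverse2)
  define c f where "c = (k + 1) div 2" and "f = k div 2"
  have cf: "k = c + f" "f \<le> c" "c \<le> f + 1" by (simp_all add: c_def f_def)
  have n: "n - p = k" using k by simp
  show ?thesis
  proof (cases "i \<le> (n + 1) div 2")
    case True
    have "(n + 1) div 2 + f \<le> n" using k by (simp add: f_def)
    then have "i \<le> n - f" using True by simp
    moreover have "k + 1 \<le> 2 * i - 1 \<longleftrightarrow> c < i" using cf by linarith
    ultimately show ?thesis using True assms(1) by (simp add: supnick_eq n c_def f_def)
  next
    case False
    have "c \<le> (n + 1) div 2" unfolding c_def using k by (intro div_le_mono) simp
    then have "c < i" using False by simp
    moreover have "f \<le> n" "i \<le> n" using k cf assms(1) by auto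
    then have "k + 1 \<le> 2 * (n - i) + 2 \<longleftrightarrow> i \<le> n - f" using cf by linarith
    ultimately show ?thesis using False assms(1) by (simp add: supnick_eq n c_def f_def)
  qed
qed

lemma supnick_le: "i \<in> {1..n} \<Longrightarrow> supnick n i \<le> n"
proof -
  assume i: "i \<in> {1..n}"
  have "2 * i - 1 \<le> n" if "i \<le> (n + 1) div 2" using that by simp
  moreover have "2 * (n - i) + 2 \<le> n" if "\<not> i \<le> (n + 1) div 2" using that i by simp
  ultimately show ?thesis using supnick_eq[OF i] by simp
qed

lemma cyc_shift_eq:
  assumes "i \<in> {1..n}" "u \<in> {1..n}"
  shows "int (cyc_shift n u i) = (int i + int u - 2) mod int n + 1"
proof (cases "i - 1 < Suc n - u")
  case True
  then have "(int i + int u - 2) mod int n = int i + int u - 2"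
    using assms by (intro mod_pos_pos_trivial) auto
  then show ?thesis using True assms
    by (simp add: cyc_shift_def one_line_def nth_append del: upt_Suc)
next
  case False
  have "(int i + int u - 2) mod int n = (int i + int u - 2 - int n) mod int n" by simp
  also have "\<dots> = int i + int u - 2 - int n"
    using False assms by (intro mod_pos_pos_trivial) auto
  finally have "(int i + int u - 2) mod int n = int i + int u - 2 - int n" .
  moreover have "[1..<u] ! (i - 1 - (Suc n - u)) = 1 + (i - 1 - (Suc n - u))"
    using False assms by (intro nth_upt) auto
  then have "cyc_shift n u i = i + u - 1 - n"
    using False assms by (simp add: cyc_shift_def one_line_def nth_append del: upt_Suc) linarith
  ultimately show ?thesis using False assms by auto
qed

text \<open>The margins between the nested level sets of sizes \<open>p \<le> q\<close> are the differences of the upper and of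
  the lower halves of \<open>b = n - p\<close> and \<open>a = n - q\<close>, so they differ by at most one.\<close>

lemma half_gaps:
  fixes a b :: nat
  assumes "a \<le> b"
  obtains l k where "(b + 1) div 2 = (a + 1) div 2 + l" "b = a + l + k" "l \<le> k + 1" "k \<le> l + 1"
proof -
  have "(b + 1) div 2 + b div 2 = b" "(a + 1) div 2 + a div 2 = a"
    "b div 2 \<le> (b + 1) div 2" "(b + 1) div 2 \<le> b div 2 + 1"
    "a div 2 \<le> (a + 1) div 2" "(a + 1) div 2 \<le> a div 2 + 1" by simp_all
  moreover obtain l where "(b + 1) div 2 = (a + 1) div 2 + l"
    using div_le_mono[of "a + 1" "b + 1" 2] assms le_iff_add by auto
  moreover obtain k where "b div 2 = a div 2 + k"
    using div_le_mono[of a b 2] assms le_iff_add by auto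
  ultimately show thesis by (intro that[of l k]) linarith+
qed

lemma PS_level_arc:
  assumes "i \<in> {1..n}" "u \<in> {1..n}" "p \<le> n"
  shows "n - p + 1 \<le> supnick n (cyc_shift n u i) \<longleftrightarrow>
    int i \<in> arc n (2 - int u + int ((n - p + 1) div 2)) p"
proof -
  let ?c = "(n - p + 1) div 2" and ?v = "(int i + int u - 2) mod int n"
  have n: "0 < n" using assms by auto
  have v: "0 \<le> ?v" "?v < int n" using n by auto
  have \<sigma>: "int (cyc_shift n u i) = ?v + 1" using cyc_shift_eq assms by simp
  then have "cyc_shift n u i \<in> {1..n}" using v by auto
  then have "n - p + 1 \<le> supnick n (cyc_shift n u i) \<longleftrightarrow>
      ?c < cyc_shift n u i \<and> cyc_shift n u i \<le> n - (n - p) div 2"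
    using supnick_level assms by simp
  also have "\<dots> \<longleftrightarrow> int ?c \<le> ?v \<and> ?v < int ?c + int p" using \<sigma> assms(3) by linarith
  also have "\<dots> \<longleftrightarrow> ?v \<in> arc n (int ?c) p"
  proof
    assume "?v \<in> arc n (int ?c) p"
    then have "int ?c \<le> ?v \<and> ?v < int ?c + int p \<or> ?v < int ?c + int p - int n"
      using v assms n by (intro arcD) linarith+
    then show "int ?c \<le> ?v \<and> ?v < int ?c + int p" using v assms(3) by linarith
  qed (use assms(3) in \<open>auto intro: arcI\<close>)
  also have "\<dots> \<longleftrightarrow> int i \<in> arc n (2 - int u + int ?c) p"
    by (simp add: arc_def mod_diff_left_eq algebra_simps)
  finally show ?thesis .
qed

section \<open>Optimality of the identity\<close>

text \<open>Off the diagonal a DW-Toeplitz matrix is a decreasing function of the cyclic distance. Its diagonal is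
  zero and so breaks the monotonicity if \<open>f 1 > 0\<close>; as permutations preserve the diagonal, \<open>\<phi> 0\<close> may be
  raised or lowered to \<open>f 1\<close>.\<close>

lemma DW_toeplitz_cyc_dist:
  assumes "DW_toeplitz n A"
  obtains \<phi> where "antimono_on {0..n div 2} \<phi>"
    and "\<And>i j. i \<in> {1..n} \<Longrightarrow> j \<in> {1..n} \<Longrightarrow> i \<noteq> j \<Longrightarrow> A i j = \<phi> (cyc_dist n (int i) (int j))"
    and "\<And>i. i \<in> {1..n} \<Longrightarrow> A i i = 0"
proof -
  obtain f where A: "\<forall>i\<in>{1..n}. \<forall>j\<in>{1..n}. A i j = f (int i - int j)"
    and circ: "\<forall>i\<in>{1..int n - 1}. f i = f (i - int n)" and f0: "f 0 = 0"
    and anti: "antimono_on {1..\<lceil>(real n - 1) / 2\<rceil>} f"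
    and refl: "\<forall>i. \<lceil>(real n - 1) / 2\<rceil> < i \<and> i \<le> int n - 1 \<longrightarrow> f i = f (int n - i)"
    using assms unfolding DW_toeplitz_def circulant_def toeplitz_def mat_eq_def by blast
  have half: "\<lceil>(real n - 1) / 2\<rceil> = int (n div 2)"
    by (cases "even n") (auto elim!: evenE oddE simp: ceiling_eq_iff)
  define \<phi> where "\<phi> d = (if d = 0 then f 1 else f (int d))" for d :: nat
  show thesis
  proof
    show "antimono_on {0..n div 2} \<phi>"
    proof (rule monotone_onI)
      fix d e :: nat assume "d \<in> {0..n div 2}" "e \<in> {0..n div 2}" "d \<le> e"
      then show "\<phi> e \<le> \<phi> d"
        using monotone_onD[OF anti[unfolded half], of "if d = 0 then 1 else int d" "int e"]
        by (cases "e = 0") (auto simp: \<phi>_def)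
    qed
    show "A i i = 0" if "i \<in> {1..n}" for i using A f0 that by simp
    fix i j assume ij: "i \<in> {1..n}" "j \<in> {1..n}" "i \<noteq> j"
    let ?k = "(int i - int j) mod int n"
    have k: "?k = (if j < i then int i - int j else int i - int j + int n)"
    proof (cases "j < i")
      case False
      have "?k = (int i - int j + int n) mod int n" by simp
      also have "\<dots> = int i - int j + int n" using ij False by (intro mod_pos_pos_trivial) auto
      finally show ?thesis using False by simp
    qed (use ij in \<open>auto intro!: mod_pos_pos_trivial\<close>)
    then have k_range: "1 \<le> ?k" "?k \<le> int n - 1" using ij by (auto split: if_splits)
    have "(int j - int i) mod int n = int n - ?k"
      using zmod_zminus1_eq_if[of "int i - int j" "int n"] k_range by simp
    then have dist: "int (cyc_dist n (int i) (int j)) = min ?k (int n - ?k)"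
      using k_range by (simp add: cyc_dist_def)
    have "f (int i - int j) = f ?k"
      using circ[rule_format, of ?k] k k_range by (auto split: if_splits)
    also have "\<dots> = f (min ?k (int n - ?k))"
    proof (cases "?k \<le> int (n div 2)")
      case True
      then have "min ?k (int n - ?k) = ?k" by linarith
      then show ?thesis by simp
    next
      case False
      then have "f ?k = f (int n - ?k)" using refl k_range by (simp add: half)
      moreover have "min ?k (int n - ?k) = int n - ?k" using False by linarith
      ultimately show ?thesis by simp
    qed
    also have "\<dots> = \<phi> (cyc_dist n (int i) (int j))"
    proof -
      have "cyc_dist n (int i) (int j) \<noteq> 0" using dist k_range by linarith
      then show ?thesis using dist by (simp add: \<phi>_def)
    qed
    finally show "A i j = \<phi> (cyc_dist n (int i) (int j))" using A ij by simp
  qed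
qed

lemma row_sum_const:
  fixes g :: "nat \<Rightarrow> real"
  shows "(\<Sum>j=1..n. g (cyc_dist n x (int j))) = (\<Sum>y\<in>{0..<int n}. g (cyc_dist n 0 y))"
proof -
  have "(\<Sum>j=1..n. g (cyc_dist n x (int j))) = (\<Sum>y\<in>{1..<1 + int n}. g (cyc_dist n x y))"
    by (rule sum.reindex_bij_witness[where i = nat and j = int]) auto
  also have "\<dots> = (\<Sum>y\<in>{x..<x + int n}. g (cyc_dist n x y))"
    by (rule periodic_sum) (simp add: cyc_dist_periodic)
  also have "\<dots> = (\<Sum>y\<in>{0..<int n}. g (cyc_dist n 0 y))"
    by (rule sum.reindex_bij_witness[where i = "\<lambda>y. y + x" and j = "\<lambda>y. y - x"])
      (auto simp: cyc_dist_def)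
  finally show ?thesis .
qed

theorem mainTheorem5:
  fixes n :: nat and A B K M :: "nat \<Rightarrow> nat \<Rightarrow> real"
  assumes "DW_toeplitz n A"
    and "kalmanson n K"
    and "cyclic_PS_monotone_Monge n M"
    and "conic_combination2 n B K M"
  shows "qap_optimal n A B id"
proof -
  obtain \<phi> where anti: "antimono_on {0..n div 2} \<phi>"
    and A: "\<And>i j. i \<in> {1..n} \<Longrightarrow> j \<in> {1..n} \<Longrightarrow> i \<noteq> j \<Longrightarrow> A i j = \<phi> (cyc_dist n (int i) (int j))"
    and A_diag: "\<And>i. i \<in> {1..n} \<Longrightarrow> A i i = 0"
    using DW_toeplitz_cyc_dist[OF assms(1)] by blast
  obtain p q u where p: "1 \<le> p" "p \<le> q" "q \<le> n" and u: "u \<in> {1..n}"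
    and M: "\<And>i j. i \<in> {1..n} \<Longrightarrow> j \<in> {1..n} \<Longrightarrow>
      M i j = - R_bar n p q (supnick n (cyc_shift n u i)) (supnick n (cyc_shift n u j))"
    using assms(3) by (auto simp: cyclic_PS_monotone_Monge_def mat_eq_def permute_mat_def)
  obtain \<alpha> \<beta> where ab: "0 \<le> \<alpha>" "0 \<le> \<beta>"
    and B: "\<And>i j. i \<in> {1..n} \<Longrightarrow> j \<in> {1..n} \<Longrightarrow> B i j = \<alpha> * K i j + \<beta> * M i j"
    using assms(4) by (auto simp: conic_combination2_def mat_eq_def)
  have n: "0 < n" using p by simp
  have "qap_cost n A B id \<le> qap_cost n A B \<rho>" if \<rho>: "\<rho> permutes {1..n}" for \<rho>
  proof -
    \<comment> \<open>The diagonal entries cancel on both sides, so \<open>D\<close> is also the change of \<open>A\<close> there.\<close>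
    define D where "D i j = \<phi> (cyc_dist n (int (\<rho> i)) (int (\<rho> j))) - \<phi> (cyc_dist n (int i) (int j))" for i j
    have \<rho>_in: "\<rho> i \<in> {1..n}" if "i \<in> {1..n}" for i using permutes_in_image[OF \<rho>] that by simp
    have D: "A (\<rho> i) (\<rho> j) - A i j = D i j" if "i \<in> {1..n}" "j \<in> {1..n}" for i j
    proof (cases "i = j")
      case False
      then have "\<rho> i \<noteq> \<rho> j" using permutes_inj[OF \<rho>] by (auto dest: injD)
      then show ?thesis using A \<rho>_in that False by (simp add: D_def)
    qed (use A_diag \<rho>_in that in \<open>simp add: D_def\<close>)
    have D_sym: "D i j = D j i" for i j
      by (simp add: D_def cyc_dist_commute[of n "int i"] cyc_dist_commute[of n "int (\<rho> i)"])
    have D_arcs: "(\<Sum>i | i \<in> {1..n} \<and> int i \<in> arc n (s + int l) a.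
        \<Sum>j | j \<in> {1..n} \<and> int j \<in> arc n s b. D i j) \<le> 0"
      if "b = l + a + k" "l \<le> k + 1" "k \<le> l + 1" "b \<le> n" for s l a b k
      using permuted_sum_le_arcs[OF anti \<rho> that(1-3) n that(4), of s] by (simp add: D_def sum_subtractf)
    have "0 \<le> (\<Sum>i=1..n. \<Sum>j=1..n. D i j * K i j)"
    proof (rule kalmanson_form_nonneg[OF assms(2) D_sym])
      show "D i i = 0" for i by (simp add: D_def)
      show "(\<Sum>j=1..n. D i j) = 0" for i
        using sum.permute[OF \<rho>, of "\<lambda>j. \<phi> (cyc_dist n (int (\<rho> i)) (int j))"]
          row_sum_const[of \<phi> n "int (\<rho> i)"] row_sum_const[of \<phi> n "int i"]
        by (simp add: D_def sum_subtractf o_def)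
      show "(\<Sum>i\<in>{a<..b}. \<Sum>j\<in>{a<..b}. D i j) \<le> 0" if "a \<le> b" "b \<le> n" for a b
      proof -
        have "int i \<in> arc n (int a + 1) (b - a) \<longleftrightarrow> a < i \<and> i \<le> b" if "i \<in> {1..n}" for i
        proof
          assume "int i \<in> arc n (int a + 1) (b - a)"
          from arcD[OF this] show "a < i \<and> i \<le> b" using that \<open>a \<le> b\<close> \<open>b \<le> n\<close> by auto
        qed (use \<open>b \<le> n\<close> in \<open>auto intro!: arcI\<close>)
        then have "{i. i \<in> {1..n} \<and> int i \<in> arc n (int a + 1) (b - a)} = {a<..b}"
          using that by auto
        then show ?thesis using D_arcs[of "b - a" 0 "b - a" 0 "int a + 1"] that by simp
      qed
    qed
    moreover have "0 \<le> (\<Sum>i=1..n. \<Sum>j=1..n. D i j * M i j)"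
    proof -
      let ?\<tau> = "\<lambda>i. supnick n (cyc_shift n u i)"
      \<comment> \<open>\<open>M\<close> is minus the symmetrised indicator of \<open>level p \<times> level q\<close>, a product of concentric arcs\<close>
      define level where "level w = {i. i \<in> {1..n} \<and> n - w + 1 \<le> ?\<tau> i}" for w
      have level_arc: "level w = {i. i \<in> {1..n} \<and> int i \<in> arc n (2 - int u + int ((n - w + 1) div 2)) w}"
        if "w \<le> n" for w
        using PS_level_arc[OF _ u that] unfolding level_def by blast
      have R: "R_mat n a b (?\<tau> i) (?\<tau> j) = of_bool (i \<in> level a) * of_bool (j \<in> level b)"
        if "i \<in> {1..n}" "j \<in> {1..n}" for a b i j
      proof -
        have "?\<tau> x \<le> n" if "x \<in> {1..n}" for x
        proof (rule supnick_le)
          have "0 \<le> (int x + int u - 2) mod int n" "(int x + int u - 2) mod int n < int n" using n by auto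
          then show "cyc_shift n u x \<in> {1..n}" using cyc_shift_eq[OF that u] by auto
        qed
        then show ?thesis using that by (simp add: R_mat_def level_def)
      qed
      have block: "(\<Sum>i=1..n. \<Sum>j=1..n. D i j * (of_bool (i \<in> level a) * of_bool (j \<in> level b)))
          = (\<Sum>i\<in>level a. \<Sum>j\<in>level b. D i j)" for a b
      proof -
        have "level w \<subseteq> {1..n}" for w by (auto simp: level_def)
        then have restrict: "(\<Sum>i=1..n. of_bool (i \<in> level w) * g i) = (\<Sum>i\<in>level w. g i)"
          for w and g :: "nat \<Rightarrow> real"
          by (intro sum.mono_neutral_cong_right) auto
        have "(\<Sum>i=1..n. \<Sum>j=1..n. D i j * (of_bool (i \<in> level a) * of_bool (j \<in> level b)))
            = (\<Sum>i=1..n. of_bool (i \<in> level a) * (\<Sum>j=1..n. of_bool (j \<in> level b) * D i j))"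
          unfolding sum_distrib_left by (intro sum.cong refl) (simp only: mult_ac)
        then show ?thesis unfolding restrict .
      qed
      have PQ: "(\<Sum>i\<in>level p. \<Sum>j\<in>level q. D i j) \<le> 0"
      proof -
        have "n - q \<le> n - p" using p by simp
        then obtain l k where lk: "(n - p + 1) div 2 = (n - q + 1) div 2 + l" "n - p = n - q + l + k"
          "l \<le> k + 1" "k \<le> l + 1" by (rule half_gaps)
        have "q = l + p + k" using lk(2) p by simp
        moreover have "level p = {i. i \<in> {1..n} \<and> int i \<in> arc n (2 - int u + int ((n - q + 1) div 2) + int l) p}"
          using level_arc[of p] p unfolding lk(1) of_nat_add add.assoc by simp
        ultimately show ?thesis unfolding level_arc[OF p(3)] using D_arcs lk(3,4) p(3) by (simp only:)
      qed
      have QP: "(\<Sum>i\<in>level q. \<Sum>j\<in>level p. D i j) = (\<Sum>i\<in>level p. \<Sum>j\<in>level q. D i j)"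
        by (subst sum.swap) (simp add: D_sym)
      show ?thesis
      proof (cases "p = q")
        case True
        have "(\<Sum>i=1..n. \<Sum>j=1..n. D i j * M i j) = - (\<Sum>i\<in>level p. \<Sum>j\<in>level q. D i j)"
          unfolding block[symmetric] sum_negf[symmetric]
          using True by (intro sum.cong refl) (simp add: M R R_bar_def)
        then show ?thesis using PQ by simp
      next
        case False
        have "(\<Sum>i=1..n. \<Sum>j=1..n. D i j * M i j)
            = - ((\<Sum>i\<in>level p. \<Sum>j\<in>level q. D i j) + (\<Sum>i\<in>level q. \<Sum>j\<in>level p. D i j))"
          unfolding block[symmetric] sum.distrib[symmetric] sum_negf[symmetric]
          using False by (intro sum.cong refl) (simp add: M R R_bar_def algebra_simps)
        then show ?thesis using PQ QP by simp
      qed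
    qed
    moreover have "qap_cost n A B \<rho> - qap_cost n A B id
        = \<alpha> * (\<Sum>i=1..n. \<Sum>j=1..n. D i j * K i j) + \<beta> * (\<Sum>i=1..n. \<Sum>j=1..n. D i j * M i j)"
      unfolding qap_cost_def sum_subtractf[symmetric] sum_distrib_left sum.distrib[symmetric]
      by (intro sum.cong refl) (simp add: B algebra_simps flip: D)
    ultimately have "0 \<le> qap_cost n A B \<rho> - qap_cost n A B id" using ab by simp
    then show ?thesis by simp
  qed
  then show ?thesis by (simp add: qap_optimal_def permutes_id)
qed

end
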